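(* Let $\mathbb{F}$ be a field, $d\ge3$, $V$ a vector space over $\mathbb{F}$ of dimension $d+1$, and $\Phi=(A;\{E_i\}_{i=0}^d;A^*;\{E^*_i\}_{i=0}^d)$ a CH system on $V$ with eigenvalue sequence $\{\theta_i\}_{i=0}^d$. Fix a nonzero vector $u^*\in E^*_0V$, and for $0\le i\le d$ let $v_i=(A-\theta_{d-i+1}I)\cdots(A-\theta_{d-1}I)(A-\theta_dI)u^*$. Then the transition matrix from the basis $\{E_iu^*\}_{i=0}^d$ to the basis $\{v_{d-i}\}_{i=0}^d$ of $V$ is upper triangular with $(i,j)$-entry $$(\theta_i-\theta_{j+1})(\theta_i-\theta_{j+2})\cdots(\theta_i-\theta_d)$$ for $0\le i\le j\le d$. Moreover, the transition matrix from $\{v_{d-i}\}_{i=0}^d$ to $\{E_iu^*\}_{i=0}^d$ is upper triangular with $(i,j)$-entry $$\frac{1}{(\theta_j-\theta_i)\cdots(\theta_j-\theta_{j-1})(\theta_j-\theta_{j+1})\cdots(\theta_j-\theta_d)}$$ for $0\le i\le j\le d$.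
   Context: An element of $\mathrm{End}(V)$ is multiplicity-free if it is diagonalizable with all eigenspaces of dimension one. The primitive idempotent of a multiplicity-free $B$ for an eigenvalue $\theta$ is the $E\in\mathrm{End}(V)$ acting as the identity on the $\theta$-eigenspace and as $0$ on the other eigenspaces. A CH system on $V$ is a sequence $\Phi=(A;\{E_i\}_{i=0}^d;A^*;\{E^*_i\}_{i=0}^d)$ in $\mathrm{End}(V)$ such that: (i) $A,A^*$ are multiplicity-free; (ii) $\{E_i\}$ is an ordering of the primitive idempotents of $A$; (iii) $\{E^*_i\}$ is an ordering of the primitive idempotents of $A^*$; (iv) $E_iA^*E_j=0$ if $1<i-j$ or $1<j-i<d$, and $E_iA^*E_j\neq0$ if $i-j=1$ or $j-i=d$; (v) $E^*_iAE^*_j=0$ if $1<i-j$ or $1<j-i<d$, and $E^*_iAE^*_j\neq0$ if $i-j=1$ or $j-i=d$ $(0\le i,j\le d)$. The eigenvalue sequence $\{\theta_i\}_{i=0}^d$ is defined by: $\theta_i$ is the eigenvalue of $A$ corresponding to $E_i$. It is known that $\{E_iu^*\}_{i=0}^d$ and $\{v_i\}_{i=0}^d$ are bases of $V$. The transition matrix from a basis $\{x_i\}_{i=0}^d$ to a basis $\{y_i\}_{i=0}^d$ is the matrix $T$ (rows and columns indexed by $0,\dots,d$) with $y_j=\sum_{i=0}^dT_{ij}x_i$ for $0\le j\le d$. Empty products equal $1$; in the last displayed denominator the product is over all $k$ with $i\le k\le d$, $k\ne j$, of $(\theta_j-\theta_k)$. *)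

theory Defs
  imports "HOL.Vector_Spaces" "Jordan_Normal_Form.Matrix"
begin

text \<open>The vector space is the whole type \<open>'b\<close>, with scalar multiplication \<open>scale\<close> over the field
  \<open>'a\<close>. Sequences indexed by \<open>0, \<dots>, d\<close> are functions on \<open>nat\<close>; their values beyond \<open>d\<close> are
  irrelevant.\<close>

definition eigenspace ::
  "('a::field \<Rightarrow> 'b::ab_group_add \<Rightarrow> 'b) \<Rightarrow> ('b \<Rightarrow> 'b) \<Rightarrow> 'a \<Rightarrow> 'b set" where
  "eigenspace scale B t = {v. B v = scale t v}"

definition eigenvalue ::
  "('a::field \<Rightarrow> 'b::ab_group_add \<Rightarrow> 'b) \<Rightarrow> ('b \<Rightarrow> 'b) \<Rightarrow> 'a \<Rightarrow> bool" where
  "eigenvalue scale B t \<longleftrightarrow> (\<exists>v. v \<noteq> 0 \<and> B v = scale t v)"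

definition diagonalizable ::
  "('a::field \<Rightarrow> 'b::ab_group_add \<Rightarrow> 'b) \<Rightarrow> ('b \<Rightarrow> 'b) \<Rightarrow> bool" where
  "diagonalizable scale B \<longleftrightarrow>
     (\<exists>X. \<not> module.dependent scale X \<and> module.span scale X = UNIV \<and>
       (\<forall>v\<in>X. \<exists>t. B v = scale t v))"

definition multiplicity_free ::
  "('a::field \<Rightarrow> 'b::ab_group_add \<Rightarrow> 'b) \<Rightarrow> ('b \<Rightarrow> 'b) \<Rightarrow> bool" where
  "multiplicity_free scale B \<longleftrightarrow> Vector_Spaces.linear scale scale B \<and> diagonalizable scale B \<and>
     (\<forall>t. eigenvalue scale B t \<longrightarrow> vector_space.dim scale (eigenspace scale B t) = 1)"

definition primitive_idempotent ::
  "('a::field \<Rightarrow> 'b::ab_group_add \<Rightarrow> 'b) \<Rightarrow> ('b \<Rightarrow> 'b) \<Rightarrow> 'a \<Rightarrow> ('b \<Rightarrow> 'b) \<Rightarrow> bool" where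
  "primitive_idempotent scale B t F \<longleftrightarrow> eigenvalue scale B t \<and> Vector_Spaces.linear scale scale F \<and>
     (\<forall>v\<in>eigenspace scale B t. F v = v) \<and>
     (\<forall>s. eigenvalue scale B s \<and> s \<noteq> t \<longrightarrow> (\<forall>v\<in>eigenspace scale B s. F v = 0))"

definition idempotent_ordering ::
  "('a::field \<Rightarrow> 'b::ab_group_add \<Rightarrow> 'b) \<Rightarrow> nat \<Rightarrow> ('b \<Rightarrow> 'b) \<Rightarrow> (nat \<Rightarrow> 'b \<Rightarrow> 'b) \<Rightarrow> bool" where
  "idempotent_ordering scale d B E \<longleftrightarrow> bij_betw E {..d} {F. \<exists>t. primitive_idempotent scale B t F}"

text \<open>The index conditions are stated over the integers, so differences are not truncated.\<close>

definition CH_relations ::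
  "('a::field \<Rightarrow> 'b::ab_group_add \<Rightarrow> 'b) \<Rightarrow> nat \<Rightarrow> (nat \<Rightarrow> 'b \<Rightarrow> 'b) \<Rightarrow> ('b \<Rightarrow> 'b) \<Rightarrow> bool" where
  "CH_relations scale d E B \<longleftrightarrow>
     (\<forall>i\<le>d. \<forall>j\<le>d.
        (1 < int i - int j \<or> (1 < int j - int i \<and> int j - int i < int d)
           \<longrightarrow> E i \<circ> B \<circ> E j = (\<lambda>_. 0)) \<and>
        (int i - int j = 1 \<or> int j - int i = int d
           \<longrightarrow> E i \<circ> B \<circ> E j \<noteq> (\<lambda>_. 0)))"

definition CH_system ::
  "('a::field \<Rightarrow> 'b::ab_group_add \<Rightarrow> 'b) \<Rightarrow> nat \<Rightarrow>
   ('b \<Rightarrow> 'b) \<Rightarrow> (nat \<Rightarrow> 'b \<Rightarrow> 'b) \<Rightarrow> ('b \<Rightarrow> 'b) \<Rightarrow> (nat \<Rightarrow> 'b \<Rightarrow> 'b) \<Rightarrow> bool" where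
  "CH_system scale d A E As Es \<longleftrightarrow>
     multiplicity_free scale A \<and> multiplicity_free scale As \<and>
     idempotent_ordering scale d A E \<and> idempotent_ordering scale d As Es \<and>
     CH_relations scale d E As \<and> CH_relations scale d Es A"

definition eigenvalue_sequence ::
  "('a::field \<Rightarrow> 'b::ab_group_add \<Rightarrow> 'b) \<Rightarrow> nat \<Rightarrow> ('b \<Rightarrow> 'b) \<Rightarrow> (nat \<Rightarrow> 'b \<Rightarrow> 'b) \<Rightarrow> (nat \<Rightarrow> 'a) \<Rightarrow> bool" where
  "eigenvalue_sequence scale d A E \<theta> \<longleftrightarrow> (\<forall>i\<le>d. primitive_idempotent scale A (\<theta> i) (E i))"

definition is_basis ::
  "('a::field \<Rightarrow> 'b::ab_group_add \<Rightarrow> 'b) \<Rightarrow> nat \<Rightarrow> (nat \<Rightarrow> 'b) \<Rightarrow> bool" where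
  "is_basis scale d x \<longleftrightarrow>
     inj_on x {..d} \<and> \<not> module.dependent scale (x ` {..d}) \<and> module.span scale (x ` {..d}) = UNIV"

text \<open>Meaningful when \<open>x\<close> is a basis; the matrix is then uniquely determined.\<close>

definition transition_matrix ::
  "('a::field \<Rightarrow> 'b::ab_group_add \<Rightarrow> 'b) \<Rightarrow> nat \<Rightarrow> (nat \<Rightarrow> 'b) \<Rightarrow> (nat \<Rightarrow> 'b) \<Rightarrow> 'a mat" where
  "transition_matrix scale d x y =
     (THE T. T \<in> carrier_mat (d + 1) (d + 1) \<and>
             (\<forall>j\<le>d. y j = (\<Sum>i\<le>d. scale (T $$ (i, j)) (x i))))"

end

theory Submission
  imports Defs
begin

text \<open>
  The eigenvectors of a multiplicity-free map attached to its primitive idempotents form a basis, so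
  the idempotents sum to the identity and have one-dimensional images. The vectors killed by \<open>E i\<close>
  form an \<open>A\<close>-invariant subspace; since \<open>A\<close> acts on the eigenbasis of \<open>A\<^sup>*\<close> with nonzero subdiagonal
  entries and nothing below them, such a subspace is everything as soon as it contains \<open>u \<noteq> 0\<close>.
  Hence \<open>E i u \<noteq> 0\<close>, and the vectors \<open>E i u\<close> form an eigenbasis of \<open>A\<close> with \<open>u = (\<Sum>i\<le>d. E i u)\<close>.
  Applying the factors \<open>A - \<theta> k\<close> to this sum gives the first matrix. The second one is its inverse
  by a telescoping sum (Newton interpolation at the nodes \<open>\<theta> d, \<dots>, \<theta> 0\<close>).
\<close>

section \<open>Bases and transition matrices in dimension \<open>d + 1\<close>\<close>

context vector_space
begin

text \<open>Counting gives the rest: a spanning set has at least \<open>d + 1\<close> elements and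
  the image of \<open>{..d}\<close> at most that many. This leaves no room for repetitions or for a
  proper spanning subset.\<close>

lemma is_basis_if_spanning:
  assumes dim: "dim (UNIV :: 'b set) = d + 1" and span: "span (x ` {..d}) = UNIV"
  shows "is_basis scale d x"
proof -
  have "dim (UNIV :: 'b set) \<le> card (x ` {..d})"
    using span by (intro dim_le_card) auto
  moreover have "card (x ` {..d}) \<le> card {..d}"
    by (intro card_image_le) auto
  ultimately have card: "card (x ` {..d}) = d + 1"
    using dim by simp
  then have inj: "inj_on x {..d}"
    by (intro eq_card_imp_inj_on) auto
  obtain B where B: "B \<subseteq> x ` {..d}" "independent B" "x ` {..d} \<subseteq> span B"
    by (rule maximal_independent_subset)
  have "span B = UNIV"
    using span_minimal[OF B(3) subspace_span] span by auto
  have "card B = d + 1"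
    using dim_eq_card[of B UNIV] B \<open>span B = UNIV\<close> dim by simp
  then have "B = x ` {..d}"
    using card B by (intro card_subset_eq) auto
  then show ?thesis
    unfolding is_basis_def using inj B \<open>span B = UNIV\<close> by auto
qed

text \<open>Applying \<open>F i\<close> to a vanishing combination isolates its \<open>i\<close>-th
  term, whence independence. An extension to a basis of the whole space adds nothing, by
  cardinality.\<close>

lemma is_basis_if_biorthogonal:
  assumes dim: "dim (UNIV :: 'b set) = d + 1"
    and lin: "\<And>i. i \<le> d \<Longrightarrow> Vector_Spaces.linear scale scale (F i)"
    and nz: "\<And>i. i \<le> d \<Longrightarrow> x i \<noteq> 0"
    and same: "\<And>i. i \<le> d \<Longrightarrow> F i (x i) = x i"
    and diff: "\<And>i j. i \<le> d \<Longrightarrow> j \<le> d \<Longrightarrow> i \<noteq> j \<Longrightarrow> F i (x j) = 0"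
  shows "is_basis scale d x"
proof -
  have inj: "inj_on x {..d}"
    using nz same diff by (metis atMost_iff inj_onI)
  have ind: "independent (x ` {..d})"
  proof
    assume "dependent (x ` {..d})"
    then obtain c w where c: "w \<in> x ` {..d}" "c w \<noteq> 0" "(\<Sum>y\<in>x ` {..d}. scale (c y) y) = 0"
      by (subst (asm) dependent_finite) auto
    then obtain i where i: "i \<le> d" "w = x i" by auto
    interpret Fi: Vector_Spaces.linear scale scale "F i" using lin i by simp
    have "0 = F i (\<Sum>j\<le>d. scale (c (x j)) (x j))"
      using c(3) inj by (simp add: sum.reindex)
    also have "\<dots> = (\<Sum>j\<le>d. if j = i then scale (c (x i)) (x i) else 0)"
      unfolding Fi.sum using i same diff
      by (intro sum.cong) (auto simp: Fi.scale)
    also have "\<dots> = scale (c w) w" using i by simp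
    finally show False using c(2) nz i by simp
  qed
  obtain B where B: "x ` {..d} \<subseteq> B" "independent B" "UNIV \<subseteq> span B"
    using maximal_independent_subset_extend[of "x ` {..d}" UNIV] ind by auto
  have "span B = UNIV" using B(3) by auto
  have "card B = d + 1"
    using dim_eq_card[of B UNIV] B(2) \<open>span B = UNIV\<close> dim by simp
  \<comment> \<open>Infinite sets have cardinality 0, so the positive value of \<open>card B\<close>
    forces finiteness.\<close>
  moreover from this have "finite B" by (intro card_ge_0_finite) simp
  moreover have "card (x ` {..d}) = d + 1" using inj by (simp add: card_image)
  ultimately have "B = x ` {..d}" using B(1) by (metis card_subset_eq)
  then show ?thesis
    unfolding is_basis_def using inj ind \<open>span B = UNIV\<close> by auto
qed

lemma is_basis_expansion:
  assumes "is_basis scale d x"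
  obtains c where "w = (\<Sum>i\<le>d. scale (c i) (x i))"
proof -
  have "w \<in> span (x ` {..d})" using assms unfolding is_basis_def by auto
  then obtain c where "w = (\<Sum>y\<in>x ` {..d}. scale (c y) y)"
    by (subst (asm) span_finite) auto
  then have "w = (\<Sum>i\<le>d. scale (c (x i)) (x i))"
    using assms unfolding is_basis_def by (simp add: sum.reindex)
  then show ?thesis by (rule that)
qed

lemma is_basis_coeff_unique:
  assumes x: "is_basis scale d x"
    and eq: "(\<Sum>i\<le>d. scale (c i) (x i)) = (\<Sum>i\<le>d. scale (c' i) (x i))"
    and i: "i \<le> d"
  shows "c i = c' i"
proof -
  have inj: "inj_on x {..d}" and ind: "independent (x ` {..d})"
    using x unfolding is_basis_def by auto
  \<comment> \<open>Dependence concerns sets of vectors, so the coefficients are carried from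
    indices to vectors through the inverse of \<open>x\<close>.\<close>
  define g where "g y = (c (inv_into {..d} x y) - c' (inv_into {..d} x y))" for y
  have g: "g (x j) = c j - c' j" if "j \<le> d" for j
    using that inj by (simp add: g_def)
  have "(\<Sum>y\<in>x ` {..d}. scale (g y) y) = (\<Sum>j\<le>d. scale (c j - c' j) (x j))"
    using inj by (simp add: sum.reindex g)
  also have "\<dots> = 0"
    using eq by (simp add: scale_left_diff_distrib sum_subtractf)
  finally have "g (x i) = 0"
    using ind i by (subst (asm) dependent_finite) auto
  then show ?thesis using g i by simp
qed

text \<open>Discharges the definite description: coefficients in a basis are unique, so exhibiting
  one suitable matrix identifies it.\<close>

lemma transition_matrix_eq:
  assumes x: "is_basis scale d x"
    and T: "T \<in> carrier_mat (d + 1) (d + 1)"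
    and eq: "\<And>j. j \<le> d \<Longrightarrow> y j = (\<Sum>i\<le>d. scale (T $$ (i, j)) (x i))"
  shows "transition_matrix scale d x y = T"
  unfolding transition_matrix_def
proof (rule the_equality)
  fix T' assume T': "T' \<in> carrier_mat (d + 1) (d + 1) \<and>
    (\<forall>j\<le>d. y j = (\<Sum>i\<le>d. scale (T' $$ (i, j)) (x i)))"
  show "T' = T"
  proof (rule eq_matI)
    fix i j assume "i < dim_row T" "j < dim_col T"
    then have ij: "i \<le> d" "j \<le> d" using T by auto
    then have "(\<Sum>i\<le>d. scale (T' $$ (i, j)) (x i)) = (\<Sum>i\<le>d. scale (T $$ (i, j)) (x i))"
      using T' eq by metis
    from is_basis_coeff_unique[OF x this ij(1)] show "T' $$ (i, j) = T $$ (i, j)" .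
  qed (use carrier_matD[OF T] carrier_matD[OF conjunct1[OF T']] in simp_all)
qed (use T eq in blast)

section \<open>Primitive idempotents and eigenbases\<close>

text \<open>Both maps are prescribed on every eigenvector, and eigenvectors span. This is what turns
  distinct idempotents into distinct eigenvalues.\<close>

lemma primitive_idempotent_cong:
  assumes diag: "diagonalizable scale B"
    and F: "primitive_idempotent scale B t F" and G: "primitive_idempotent scale B t G"
  shows "F = G"
proof -
  obtain X where X: "span X = UNIV" "\<And>w. w \<in> X \<Longrightarrow> \<exists>s. B w = scale s w"
    using diag unfolding diagonalizable_def by auto
  interpret F: Vector_Spaces.linear scale scale F using F unfolding primitive_idempotent_def by simp
  interpret G: Vector_Spaces.linear scale scale G using G unfolding primitive_idempotent_def by simp
  have FG: "F w = G w" if w: "w \<in> X" for w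
  proof (cases "w = 0")
    case True
    then show ?thesis by (simp add: F.zero G.zero)
  next
    case False
    obtain s where "B w = scale s w" using X(2) w by blast
    then have s: "w \<in> eigenspace scale B s" "eigenvalue scale B s"
      using False unfolding eigenspace_def eigenvalue_def by auto
    show ?thesis
    proof (cases "s = t")
      case True
      then show ?thesis using s F G unfolding primitive_idempotent_def by auto
    next
      case False
      then have "F w = 0" "G w = 0" using s F G unfolding primitive_idempotent_def by blast+
      then show ?thesis by simp
    qed
  qed
  have "F w = G w" if "w \<in> span X" for w
    using that
    by (induction rule: span_induct_alt) (auto simp: FG F.zero G.zero F.add G.add F.scale G.scale)
  then show ?thesis using X by auto
qed

text \<open>Injectivity of the ordering makes the \<open>t i\<close> distinct; one eigenvector
  chosen for each is then biorthogonal to the idempotents. Serves both \<open>A\<close> and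
  \<open>As\<close>.\<close>

lemma idempotent_ordering_eigenbasis:
  assumes dim: "dim (UNIV :: 'b set) = d + 1"
    and mf: "multiplicity_free scale B"
    and ord: "idempotent_ordering scale d B E"
    and prim: "\<And>i. i \<le> d \<Longrightarrow> primitive_idempotent scale B (t i) (E i)"
  obtains x where "is_basis scale d x"
    "\<And>i. i \<le> d \<Longrightarrow> B (x i) = scale (t i) (x i)"
    "\<And>i j. i \<le> d \<Longrightarrow> j \<le> d \<Longrightarrow> E i (x j) = (if i = j then x j else 0)"
    "\<And>i. i \<le> d \<Longrightarrow> x i \<noteq> 0"
    "inj_on t {..d}"
proof -
  have inj: "inj_on t {..d}"
  proof (rule inj_onI)
    fix i j assume ij: "i \<in> {..d}" "j \<in> {..d}" "t i = t j"
    then have "primitive_idempotent scale B (t i) (E i)" "primitive_idempotent scale B (t i) (E j)"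
      using prim[of i] prim[of j] by auto
    then have "E i = E j"
      using primitive_idempotent_cong mf unfolding multiplicity_free_def by blast
    then show "i = j"
      using ord ij unfolding idempotent_ordering_def bij_betw_def by (meson inj_onD)
  qed
  have "\<exists>w. w \<noteq> 0 \<and> B w = scale (t i) w" if "i \<le> d" for i
    using prim[OF that] unfolding primitive_idempotent_def eigenvalue_def by blast
  then obtain x where x: "\<And>i. i \<le> d \<Longrightarrow> x i \<noteq> 0" "\<And>i. i \<le> d \<Longrightarrow> B (x i) = scale (t i) (x i)"
    by metis
  have E: "E i (x j) = (if i = j then x j else 0)" if ij: "i \<le> d" "j \<le> d" for i j
  proof -
    have "x j \<in> eigenspace scale B (t j)" "eigenvalue scale B (t j)"
      using x ij unfolding eigenspace_def eigenvalue_def by auto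
    moreover have "t i = t j \<longleftrightarrow> i = j" using inj ij by (auto simp: inj_on_eq_iff)
    ultimately show ?thesis
      using prim[OF ij(1)] unfolding primitive_idempotent_def by (cases "i = j") auto
  qed
  have "is_basis scale d x"
    by (rule is_basis_if_biorthogonal[OF dim, where F = E])
      (use prim x E in \<open>auto simp: primitive_idempotent_def\<close>)
  then show ?thesis using that x E inj by blast
qed

lemma biorthogonal_apply:
  fixes d :: nat
  assumes lin: "Vector_Spaces.linear scale scale F" and i: "i \<le> d"
    and F: "\<And>j. j \<le> d \<Longrightarrow> F (x j) = (if i = j then x j else 0)"
  shows "F (\<Sum>j\<le>d. scale (c j) (x j)) = scale (c i) (x i)"
proof -
  interpret F: Vector_Spaces.linear scale scale F by (rule lin)
  have "F (\<Sum>j\<le>d. scale (c j) (x j)) = (\<Sum>j\<le>d. if j = i then scale (c i) (x i) else 0)"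
    unfolding F.sum by (intro sum.cong) (auto simp: F.scale F)
  then show ?thesis using i by simp
qed

section \<open>The action of \<open>A\<close> on bases\<close>

text \<open>The basis vectors enter \<open>W\<close> one by one: \<open>x 0\<close> is a multiple of
  \<open>u\<close>, and \<open>A (x k)\<close> has a nonzero component along
  \<open>x (Suc k)\<close>, none beyond it, and all others already in \<open>W\<close>.\<close>

lemma invariant_subspace_eq_UNIV:
  assumes Es: "\<And>i. i \<le> d \<Longrightarrow> Vector_Spaces.linear scale scale (Es i)"
    and x: "is_basis scale d x"
    and Esx: "\<And>i j. i \<le> d \<Longrightarrow> j \<le> d \<Longrightarrow> Es i (x j) = (if i = j then x j else 0)"
    and A: "Vector_Spaces.linear scale scale A"
    and CH: "CH_relations scale d Es A"
    and W: "subspace W" and inv: "\<And>w. w \<in> W \<Longrightarrow> A w \<in> W"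
    and u: "u \<in> range (Es 0)" "u \<noteq> 0" "u \<in> W"
  shows "W = UNIV"
proof -
  \<comment> \<open>One expansion yields both the resolution of the identity (\<open>sum\<close>)
    and the fact that each \<open>Es i\<close> maps into a line (\<open>range\<close>).\<close>
  have proj: "\<exists>c. w = (\<Sum>j\<le>d. scale (c j) (x j)) \<and> (\<forall>i\<le>d. Es i w = scale (c i) (x i))" for w
  proof -
    obtain c where c: "w = (\<Sum>j\<le>d. scale (c j) (x j))"
      using is_basis_expansion[OF x] .
    have "Es i w = scale (c i) (x i)" if "i \<le> d" for i
      unfolding c by (rule biorthogonal_apply) (use that Es Esx in auto)
    then show ?thesis using c by blast
  qed
  have sum: "w = (\<Sum>i\<le>d. Es i w)" for w
    using proj[of w] by auto
  have range: "\<exists>c. Es i w = scale c (x i)" if "i \<le> d" for i w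
    using proj[of w] that by auto
  have mem: "x i \<in> W" if "w \<in> W" "w \<noteq> 0" "w = scale c (x i)" for w c i
  proof -
    have "c \<noteq> 0" using that by auto
    then have "x i = scale (inverse c) w" using that by simp
    then show ?thesis using W that(1) by (simp add: subspace_scale)
  qed
  have "\<forall>i\<le>k. x i \<in> W" if "k \<le> d" for k
    using that
  proof (induction k)
    case 0
    obtain w c where "u = Es 0 w" "Es 0 w = scale c (x 0)" using u(1) range[of 0] by blast
    then have "x 0 \<in> W" using mem[of u c 0] u by simp
    then show ?case by simp
  next
    case (Suc k)
    have zero: "Es i (A (x k)) = 0" if "i \<le> d" "i > Suc k" for i
    proof -
      have "Es i \<circ> A \<circ> Es k = (\<lambda>_. 0)"
        using CH that Suc.prems unfolding CH_relations_def by auto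
      from fun_cong[OF this, of "x k"] show ?thesis
        using Esx[of k k] Suc.prems by simp
    qed
    \<comment> \<open>The CH condition only says that a composition is nonzero; as
      \<open>Es k\<close> maps onto the line of \<open>x k\<close>, this is decided at
      \<open>x k\<close>.\<close>
    have nonzero: "Es (Suc k) (A (x k)) \<noteq> 0"
    proof
      assume *: "Es (Suc k) (A (x k)) = 0"
      interpret A: Vector_Spaces.linear scale scale A by (rule A)
      interpret Ek: Vector_Spaces.linear scale scale "Es (Suc k)" using Es Suc.prems by simp
      have "Es (Suc k) \<circ> A \<circ> Es k = (\<lambda>_. 0)"
      proof
        fix w
        obtain c where "Es k w = scale c (x k)" using range[of k w] Suc.prems by auto
        then show "(Es (Suc k) \<circ> A \<circ> Es k) w = 0"
          using * by (simp add: A.scale Ek.scale)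
      qed
      then show False
        using CH Suc.prems unfolding CH_relations_def by auto
    qed
    have xW: "x i \<in> W" if "i \<le> k" for i using Suc that by auto
    have low: "Es i (A (x k)) \<in> W" if ik: "i \<le> k" for i
    proof -
      obtain c where "Es i (A (x k)) = scale c (x i)"
        using range[of i "A (x k)"] ik Suc.prems by auto
      then show ?thesis using xW[OF ik] W by (simp add: subspace_scale)
    qed
    have "A (x k) = (\<Sum>i\<le>d. Es i (A (x k)))" by (rule sum)
    also have "\<dots> = (\<Sum>i\<le>Suc k. Es i (A (x k)))"
      using Suc.prems zero by (intro sum.mono_neutral_right) auto
    \<comment> \<open>The truncated expansion of \<open>A (x k)\<close> is solved for its top
      term.\<close>
    finally have "Es (Suc k) (A (x k)) = A (x k) - (\<Sum>i\<le>k. Es i (A (x k)))"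
      by (simp add: algebra_simps)
    moreover have "A (x k) - (\<Sum>i\<le>k. Es i (A (x k))) \<in> W"
      using W inv xW low by (intro subspace_diff subspace_sum) auto
    ultimately have "Es (Suc k) (A (x k)) \<in> W" by simp
    then have "x (Suc k) \<in> W"
      using range[OF Suc.prems, of "A (x k)"] nonzero mem by blast
    then show ?case using xW by (auto simp: le_Suc_eq)
  qed
  then have "x ` {..d} \<subseteq> W" by auto
  then have "span (x ` {..d}) \<subseteq> W" using W by (rule span_minimal)
  then show ?thesis using x unfolding is_basis_def by auto
qed

text \<open>Each factor \<open>A - \<theta> k\<close> rescales \<open>e i\<close> by
  \<open>\<theta> i - \<theta> k\<close>. With \<open>e i = E i u\<close> the coefficients become
  the entries of the first matrix.\<close>

lemma foldr_factors_eigenvector_sum: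
  fixes d :: nat
  assumes A: "Vector_Spaces.linear scale scale A"
    and e: "\<And>i. i \<le> d \<Longrightarrow> A (e i) = scale (\<theta> i) (e i)"
  shows "foldr (\<lambda>k w. A w - scale (\<theta> k) w) ks (\<Sum>i\<le>d. e i) =
    (\<Sum>i\<le>d. scale (\<Prod>k\<leftarrow>ks. \<theta> i - \<theta> k) (e i))"
proof (induction ks)
  case Nil
  then show ?case by simp
next
  case (Cons k ks)
  interpret A: Vector_Spaces.linear scale scale A by (rule A)
  show ?case
    unfolding foldr.simps o_apply Cons.IH A.sum scale_sum_right sum_subtractf[symmetric]
    by (intro sum.cong) (auto simp: A.scale e algebra_simps)
qed

end

section \<open>Newton interpolation identities\<close>

text \<open>Multiplying by \<open>x - \<theta> j\<close> makes the sum telescope, since \<open>x - \<theta> j = (x - \<theta> i) - (\<theta> j - \<theta> i)\<close>.\<close>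

lemma sum_newton_telescope:
  fixes \<theta> :: "nat \<Rightarrow> 'a::field"
  assumes inj: "inj_on \<theta> {..d}" and mj: "m \<le> j" and jd: "j \<le> d"
  shows "(x - \<theta> j) * (\<Sum>i=m..j. (\<Prod>k\<in>{i + 1..d}. x - \<theta> k) / (\<Prod>k\<in>{i..d} - {j}. \<theta> j - \<theta> k)) =
    (\<Prod>k\<in>{m..d}. x - \<theta> k) / (\<Prod>k\<in>{m..d} - {j}. \<theta> j - \<theta> k)"
  using mj
proof (induction m rule: inc_induct)
  \<comment> \<open>The sum has the single term \<open>i = j\<close>, and
    \<open>x - \<theta> j\<close> supplies the missing factor of the numerator.\<close>
  case base
  have "{j..d} = insert j {j + 1..d}" using jd by auto
  then show ?case by simp
next
  case (step m)
  have md: "m < j" "m \<le> d" using step jd by auto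
  have ne: "\<theta> j - \<theta> m \<noteq> 0"
    using inj md jd by (auto simp: inj_on_eq_iff)
  have ne': "(\<Prod>k\<in>{Suc m..d} - {j}. \<theta> j - \<theta> k) \<noteq> 0"
    using inj jd by (auto simp: inj_on_eq_iff)
  have 1: "{m..d} = insert m {Suc m..d}" using md by auto
  have 2: "{m..d} - {j} = insert m ({Suc m..d} - {j})" using md by auto
  have 3: "{m..j} = insert m {Suc m..j}" using md by auto
  have D: "(\<Prod>k\<in>{m..d} - {j}. \<theta> j - \<theta> k) =
      (\<theta> j - \<theta> m) * (\<Prod>k\<in>{Suc m..d} - {j}. \<theta> j - \<theta> k)"
    unfolding 2 by simp
  have P: "(\<Prod>k\<in>{m..d}. x - \<theta> k) = (x - \<theta> m) * (\<Prod>k\<in>{Suc m..d}. x - \<theta> k)"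
    unfolding 1 by simp
  \<comment> \<open>The new term has the denominator \<open>D\<close> of the goal; over it the two
    contributions carry \<open>x - \<theta> j\<close> and \<open>\<theta> j - \<theta> m\<close>,
    which add up to \<open>x - \<theta> m\<close>.\<close>
  show ?case
    unfolding 3 using step.IH ne ne'
    by (simp add: D P distrib_left) (simp add: field_simps)
qed

text \<open>The sum is the Lagrange polynomial of the node \<open>\<theta> j\<close> in Newton form,
  evaluated at \<open>\<theta> l\<close>. It is the \<open>(l, j)\<close> entry of the product of
  the two transition matrices.\<close>

lemma sum_newton_inverse:
  fixes \<theta> :: "nat \<Rightarrow> 'a::field"
  assumes inj: "inj_on \<theta> {..d}" and l: "l \<le> d" and j: "j \<le> d"
  shows "(\<Sum>i\<le>j. (\<Prod>k\<in>{i + 1..d}. \<theta> l - \<theta> k) / (\<Prod>k\<in>{i..d} - {j}. \<theta> j - \<theta> k)) =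
    (if l = j then 1 else 0)"
proof (cases "l = j")
  case False
  \<comment> \<open>The factor \<open>k = l\<close> vanishes.\<close>
  have "(\<Prod>k\<in>{0..d}. \<theta> l - \<theta> k) = 0" using l by (auto intro: prod_zero)
  moreover have "\<theta> l - \<theta> j \<noteq> 0" using inj False l j by (auto simp: inj_on_eq_iff)
  ultimately show ?thesis
    using sum_newton_telescope[OF inj _ j, of 0 "\<theta> l"] False
    by (simp add: atLeast0AtMost del: prod_zero_iff)
next
  \<comment> \<open>Here \<open>\<theta> l - \<theta> j\<close> is 0 and cannot be cancelled, so the
    sum is evaluated directly: only the term \<open>i = j\<close> survives.\<close>
  case True
  have "(\<Prod>k\<in>{i + 1..d}. \<theta> j - \<theta> k) = 0" if "i < j" for i
    using that j by (intro prod_zero) auto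
  then have "(\<Sum>i\<le>j. (\<Prod>k\<in>{i + 1..d}. \<theta> j - \<theta> k) / (\<Prod>k\<in>{i..d} - {j}. \<theta> j - \<theta> k)) =
    (\<Sum>i\<in>{j}. (\<Prod>k\<in>{i + 1..d}. \<theta> j - \<theta> k) / (\<Prod>k\<in>{i..d} - {j}. \<theta> j - \<theta> k))"
    by (intro sum.mono_neutral_right) (auto simp: le_less)
  moreover have "{j..d} - {j} = {j + 1..d}" by auto
  moreover have "(\<Prod>k\<in>{j + 1..d}. \<theta> j - \<theta> k) \<noteq> 0"
    using inj j by (auto simp: inj_on_eq_iff)
  ultimately show ?thesis using True by simp
qed

section \<open>The two transition matrices of a CH system\<close>

theorem lemma6p3:
  fixes scale :: "'a::field \<Rightarrow> 'b::ab_group_add \<Rightarrow> 'b"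
    and d :: nat
    and A As :: "'b \<Rightarrow> 'b"
    and E Es :: "nat \<Rightarrow> 'b \<Rightarrow> 'b"
    and \<theta> :: "nat \<Rightarrow> 'a"
    and u :: 'b
    and v :: "nat \<Rightarrow> 'b"
  assumes "vector_space scale"
    and "d \<ge> 3"
    and "vector_space.dim scale (UNIV :: 'b set) = d + 1"
    and "CH_system scale d A E As Es"
    and "eigenvalue_sequence scale d A E \<theta>"
    and "u \<in> range (Es 0)" and "u \<noteq> 0"
    and "\<And>i. i \<le> d \<Longrightarrow>
           v i = foldr (\<lambda>k w. A w - scale (\<theta> k) w) [d - i + 1..<d + 1] u"
  shows "is_basis scale d (\<lambda>i. E i u) \<and>
         is_basis scale d (\<lambda>i. v (d - i)) \<and>
         upper_triangular
           (transition_matrix scale d (\<lambda>i. E i u) (\<lambda>i. v (d - i))) \<and>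
         (\<forall>i j. i \<le> j \<and> j \<le> d \<longrightarrow>
           transition_matrix scale d (\<lambda>i. E i u) (\<lambda>i. v (d - i)) $$ (i, j) =
             (\<Prod>k\<in>{j + 1..d}. \<theta> i - \<theta> k)) \<and>
         upper_triangular
           (transition_matrix scale d (\<lambda>i. v (d - i)) (\<lambda>i. E i u)) \<and>
         (\<forall>i j. i \<le> j \<and> j \<le> d \<longrightarrow>
           transition_matrix scale d (\<lambda>i. v (d - i)) (\<lambda>i. E i u) $$ (i, j) =
             1 / (\<Prod>k\<in>{i..d} - {j}. \<theta> j - \<theta> k))"
proof -
  interpret vector_space scale by fact
  note dim = assms(3)
  have mf: "multiplicity_free scale A" "multiplicity_free scale As"
    and ord: "idempotent_ordering scale d A E" "idempotent_ordering scale d As Es"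
    and CH: "CH_relations scale d Es A"
    using assms(4) unfolding CH_system_def by auto
  have linA: "Vector_Spaces.linear scale scale A"
    using mf unfolding multiplicity_free_def by simp
  interpret A: Vector_Spaces.linear scale scale A by (rule linA)
  have prim: "\<And>i. i \<le> d \<Longrightarrow> primitive_idempotent scale A (\<theta> i) (E i)"
    using assms(5) unfolding eigenvalue_sequence_def by simp
  then have linE: "\<And>i. i \<le> d \<Longrightarrow> Vector_Spaces.linear scale scale (E i)"
    unfolding primitive_idempotent_def by simp
  obtain x where x: "is_basis scale d x"
    and Ax: "\<And>i. i \<le> d \<Longrightarrow> A (x i) = scale (\<theta> i) (x i)"
    and Ex: "\<And>i j. i \<le> d \<Longrightarrow> j \<le> d \<Longrightarrow> E i (x j) = (if i = j then x j else 0)"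
    and xnz: "\<And>i. i \<le> d \<Longrightarrow> x i \<noteq> 0"
    and inj: "inj_on \<theta> {..d}"
    using idempotent_ordering_eigenbasis[OF dim mf(1) ord(1) prim] by metis
  \<comment> \<open>Only \<open>A\<close> comes with an eigenvalue sequence; one for
    \<open>As\<close> is chosen from its ordering.\<close>
  have "\<exists>t. primitive_idempotent scale As t (Es i)" if "i \<le> d" for i
    using ord(2) that unfolding idempotent_ordering_def bij_betw_def by auto
  then obtain t where primEs: "\<And>i. i \<le> d \<Longrightarrow> primitive_idempotent scale As (t i) (Es i)"
    by metis
  then have linEs: "\<And>i. i \<le> d \<Longrightarrow> Vector_Spaces.linear scale scale (Es i)"
    unfolding primitive_idempotent_def by simp
  obtain y where y: "is_basis scale d y"
    and Esy: "\<And>i j. i \<le> d \<Longrightarrow> j \<le> d \<Longrightarrow> Es i (y j) = (if i = j then y j else 0)"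
    using idempotent_ordering_eigenbasis[OF dim mf(2) ord(2) primEs] by metis

  have E_expand: "E i (\<Sum>j\<le>d. scale (c j) (x j)) = scale (c i) (x i)" if "i \<le> d" for i c
    using biorthogonal_apply[of "E i" i d x c] linE Ex that by simp
  have A_expand: "A (\<Sum>j\<le>d. scale (c j) (x j)) = (\<Sum>j\<le>d. scale (\<theta> j * c j) (x j))" for c
    unfolding A.sum by (intro sum.cong) (auto simp: A.scale Ax mult.commute)
  \<comment> \<open>This makes the kernel of \<open>E i\<close> invariant under
    \<open>A\<close>.\<close>
  have EA: "E i (A w) = scale (\<theta> i) (E i w)" if "i \<le> d" for i w
  proof -
    obtain c where "w = (\<Sum>j\<le>d. scale (c j) (x j))" using is_basis_expansion[OF x] .
    then show ?thesis using that by (simp add: A_expand E_expand)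
  qed
  obtain c where c: "u = (\<Sum>j\<le>d. scale (c j) (x j))" using is_basis_expansion[OF x] .
  have Eu: "E i u = scale (c i) (x i)" if "i \<le> d" for i
    using that c E_expand by simp
  have Eu_nz: "E i u \<noteq> 0" if i: "i \<le> d" for i
  proof
    assume "E i u = 0"
    interpret Ei: Vector_Spaces.linear scale scale "E i" using linE i .
    have "subspace {w. E i w = 0}"
      unfolding subspace_def by (auto simp: Ei.zero Ei.add Ei.scale)
    then have "{w. E i w = 0} = UNIV"
      by (intro invariant_subspace_eq_UNIV[OF _ y _ linA CH _ _ assms(6,7)])
        (use linEs Esy EA i \<open>E i u = 0\<close> in auto)
    then have "E i (x i) = 0" by auto
    then show False using Ex[of i i] xnz i by simp
  qed
  have E_scale: "E i (scale a w) = scale a (E i w)" if "i \<le> d" for i a w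
  proof -
    interpret Ei: Vector_Spaces.linear scale scale "E i" using linE that .
    show ?thesis by (rule Ei.scale)
  qed
  have basisE: "is_basis scale d (\<lambda>i. E i u)"
    by (rule is_basis_if_biorthogonal[OF dim, where F = E])
      (use linE Eu_nz Eu E_scale Ex in auto)
  have AEu: "A (E i u) = scale (\<theta> i) (E i u)" if "i \<le> d" for i
    using that by (simp add: Eu A.scale Ax mult.commute)
  have u_sum: "u = (\<Sum>i\<le>d. E i u)"
    using c Eu by simp
  have v: "v (d - j) = (\<Sum>i\<le>d. scale (\<Prod>k\<in>{j + 1..d}. \<theta> i - \<theta> k) (E i u))" if "j \<le> d" for j
  proof -
    \<comment> \<open>As \<open>j \<le> d\<close>, the truncated difference
      \<open>d - (d - j)\<close> equals \<open>j\<close>.\<close>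
    have "v (d - j) = foldr (\<lambda>k w. A w - scale (\<theta> k) w) [j + 1..<d + 1] u"
      using assms(8)[of "d - j"] that by simp
    also have "\<dots> = foldr (\<lambda>k w. A w - scale (\<theta> k) w) [j + 1..<d + 1] (\<Sum>i\<le>d. E i u)"
      using u_sum by simp
    also have "\<dots> = (\<Sum>i\<le>d. scale (\<Prod>k\<leftarrow>[j + 1..<d + 1]. \<theta> i - \<theta> k) (E i u))"
      using linA AEu by (rule foldr_factors_eigenvector_sum)
    also have "\<dots> = (\<Sum>i\<le>d. scale (\<Prod>k\<in>{j + 1..d}. \<theta> i - \<theta> k) (E i u))"
      by (simp only: prod.set_conv_list[symmetric] prod.distinct_set_conv_list[OF distinct_upt, symmetric]
          set_upt Suc_eq_plus1[symmetric] atLeastLessThanSuc_atLeastAtMost)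
    finally show ?thesis .
  qed
  \<comment> \<open>No case split is needed below the diagonal: for \<open>i > j\<close> the product
    contains the zero factor \<open>k = i\<close>.\<close>
  define T where "T = mat (d + 1) (d + 1) (\<lambda>(i, j). \<Prod>k\<in>{j + 1..d}. \<theta> i - \<theta> k)"
  define S where "S = mat (d + 1) (d + 1)
    (\<lambda>(i, j). if i \<le> j then 1 / (\<Prod>k\<in>{i..d} - {j}. \<theta> j - \<theta> k) else 0)"
  have E_sum: "E j u = (\<Sum>i\<le>d. scale (S $$ (i, j)) (v (d - i)))" if j: "j \<le> d" for j
  proof -
    have "(\<Sum>i\<le>d. scale (S $$ (i, j)) (v (d - i))) =
      (\<Sum>i\<le>j. scale (1 / (\<Prod>k\<in>{i..d} - {j}. \<theta> j - \<theta> k)) (v (d - i)))"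
      using j by (intro sum.mono_neutral_cong_right) (auto simp: S_def)
    also have "\<dots> = (\<Sum>i\<le>j. \<Sum>l\<le>d. scale ((\<Prod>k\<in>{i + 1..d}. \<theta> l - \<theta> k) /
        (\<Prod>k\<in>{i..d} - {j}. \<theta> j - \<theta> k)) (E l u))"
      using j by (intro sum.cong) (auto simp: v scale_sum_right)
    \<comment> \<open>After exchanging the sums, the coefficient of \<open>E l u\<close> is the
      \<open>(l, j)\<close> entry of \<open>T\<close> times \<open>S\<close>.\<close>
    also have "\<dots> = (\<Sum>l\<le>d. scale (\<Sum>i\<le>j. (\<Prod>k\<in>{i + 1..d}. \<theta> l - \<theta> k) /
        (\<Prod>k\<in>{i..d} - {j}. \<theta> j - \<theta> k)) (E l u))"
      by (subst sum.swap) (simp add: scale_sum_left)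
    also have "\<dots> = (\<Sum>l\<le>d. if l = j then E j u else 0)"
      using sum_newton_inverse[OF inj _ j] by (intro sum.cong) auto
    also have "\<dots> = E j u" using j by simp
    finally show ?thesis by simp
  qed
  \<comment> \<open>By \<open>E_sum\<close> the \<open>d + 1\<close> vectors
    \<open>v (d - i)\<close> span a known basis, hence form a basis themselves.\<close>
  have "(\<lambda>i. E i u) ` {..d} \<subseteq> span ((\<lambda>i. v (d - i)) ` {..d})"
    using E_sum by (auto intro!: span_sum span_scale intro: span_base)
  then have "span ((\<lambda>i. E i u) ` {..d}) \<subseteq> span ((\<lambda>i. v (d - i)) ` {..d})"
    by (rule span_minimal) (rule subspace_span)
  then have "span ((\<lambda>i. v (d - i)) ` {..d}) = UNIV"
    using basisE unfolding is_basis_def by auto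
  then have basisv: "is_basis scale d (\<lambda>i. v (d - i))"
    by (rule is_basis_if_spanning[OF dim])
  have T: "transition_matrix scale d (\<lambda>i. E i u) (\<lambda>i. v (d - i)) = T"
    by (rule transition_matrix_eq[OF basisE]) (auto simp: T_def v)
  have S: "transition_matrix scale d (\<lambda>i. v (d - i)) (\<lambda>i. E i u) = S"
    by (rule transition_matrix_eq[OF basisv]) (use E_sum in \<open>auto simp: S_def\<close>)
  have "upper_triangular T"
    by (auto simp: upper_triangular_def T_def intro!: prod_zero)
  moreover have "upper_triangular S"
    by (auto simp: upper_triangular_def S_def)
  ultimately show ?thesis
    unfolding T S using basisE basisv by (auto simp: T_def S_def)
qed

end
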